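(* Let $J,R,Q\in\mathbb{R}^{n\times n}$, $B,V\in\mathbb{R}^{n\times m}$, $N,W\in\mathbb{R}^{m\times m}$ and $G\in\mathbb{R}^{n\times k}$ be real matrices with $J,N$ skew-symmetric, $R,W$ symmetric, $\begin{bmatrix}R&V\\ V^\top&W\end{bmatrix}$ positive semidefinite, and $Q$ symmetric (possibly indefinite). Consider the port-Hamiltonian DAE system with Hamiltonian $\mathcal H(x)=\frac12 x^\top Qx$, state $x$, input $u$, output $y$ and Lagrange multiplier vector $\lambda$ $$\begin{aligned}\dot x&=(J-R)Qx+(B-V)u+G\lambda,\\ y&=(B+V)^\top Qx+(N+W)u,\\ 0&=G^\top Qx.\end{aligned}$$ Assume that $Q$ is invertible and, without loss of generality, that $G$ has full column rank. Then, by differentiating the constraint $G^\top Qx=0$ with respect to time and substituting the expression for $\dot x$, the Lagrange multiplier vector is determined as $$\lambda=-(G^\top QG)^{-1}G^\top Q(J-R)Qx-(G^\top QG)^{-1}G^\top Q(B-V)u.$$ Substituting this into the system leads to the standard input-state-output system $$\dot x=\Pi(J-R)Qx+\Pi(B-V)u,\qquad y=(B+V)^\top Qx+(N+W)u,$$ where $\Pi:=I-G(G^\top QG)^{-1}G^\top Q$ is a projection matrix onto $\ker G^\top Q$, orthogonal with respect to the (possibly indefinite) inner product defined by $Q$. The subspace $\ker G^\top Q$ is an invariant subspace of this input-state-output system. Its transfer function from $u$ to $y$ is $$(B+V)^\top Q\bigl(sI-\Pi(J-R)Q\bigr)^{-1}\Pi(B-V)+(N+W),$$ and this transfer function is positive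 real if $Q>0$ (that is, if $Q$ is positive definite).
   Context: A subspace $\mathcal{V}$ is invariant for a system $\dot x=Ax+Fu$ if $x(0)\in\mathcal{V}$ implies $x(t)\in\mathcal{V}$ for all $t$ and all inputs $u$. The transfer function of $\dot x=Ax+Fu$, $y=Cx+Du$ is the rational matrix $C(sI-A)^{-1}F+D$ in the complex variable $s$. A real rational square matrix $T(s)$ is positive real if it is analytic in $\mathrm{Re}\, s>0$ and $T(s)+T(s)^*\ge 0$ for all $s$ with $\mathrm{Re}\, s>0$, where ${}^*$ denotes conjugate transpose. The inner product defined by $Q$ is $(x,x')\mapsto x^\top Qx'$.
   Formalization: For indefinite Q, invertibility of G^T Q G is assumed, since it can fail (Q=diag(1,-1), G=(1,1)^T) and then the formulas for λ and Π are undefined; for Q>0 it is proved. All dimensions n, m, k are at least 1. *)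

theory Defs
  imports "HOL-Analysis.Analysis" "HOL-Computational_Algebra.Computational_Algebra"
    "HOL-Computational_Algebra.Field_as_Ring"
begin

definition pos_semidef :: "real^'n^'n \<Rightarrow> bool" where
  "pos_semidef M \<longleftrightarrow> transpose M = M \<and> (\<forall>x. 0 \<le> x \<bullet> (M *v x))"

definition pos_def :: "real^'n^'n \<Rightarrow> bool" where
  "pos_def M \<longleftrightarrow> transpose M = M \<and> (\<forall>x. x \<noteq> 0 \<longrightarrow> 0 < x \<bullet> (M *v x))"

definition block_matrix ::
    "'a^'n^'n \<Rightarrow> 'a^'m^'n \<Rightarrow> 'a^'n^'m \<Rightarrow> 'a^'m^'m \<Rightarrow> 'a^('n + 'm)^('n + 'm)" where
  "block_matrix M11 M12 M21 M22 =
     (\<chi> i j. case i of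
        Inl a \<Rightarrow> (case j of Inl b \<Rightarrow> M11 $ a $ b | Inr b \<Rightarrow> M12 $ a $ b)
      | Inr a \<Rightarrow> (case j of Inl b \<Rightarrow> M21 $ a $ b | Inr b \<Rightarrow> M22 $ a $ b))"

definition mat_ker :: "real^'n^'m \<Rightarrow> (real^'n) set" where
  "mat_ker M = {x. M *v x = 0}"

definition conj_transpose :: "complex^'n^'m \<Rightarrow> complex^'m^'n" where
  "conj_transpose M = (\<chi> i j. cnj (M $ j $ i))"

definition hermitian_pos_semidef :: "complex^'n^'n \<Rightarrow> bool" where
  "hermitian_pos_semidef M \<longleftrightarrow>
     conj_transpose M = M \<and>
     (\<forall>v. 0 \<le> Re (\<Sum>i\<in>UNIV. cnj (v $ i) * (M *v v) $ i))"

definition Q_inner :: "real^'n^'n \<Rightarrow> real^'n \<Rightarrow> real^'n \<Rightarrow> real" where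
  "Q_inner Q x x' = x \<bullet> (Q *v x')"

definition projection_onto :: "real^'n^'n \<Rightarrow> (real^'n) set \<Rightarrow> bool" where
  "projection_onto P S \<longleftrightarrow> P ** P = P \<and> range (\<lambda>x. P *v x) = S"

definition Q_orthogonal_projection :: "real^'n^'n \<Rightarrow> real^'n^'n \<Rightarrow> (real^'n) set \<Rightarrow> bool" where
  "Q_orthogonal_projection Q P S \<longleftrightarrow>
     projection_onto P S \<and> (\<forall>v\<in>S. \<forall>w\<in>mat_ker P. Q_inner Q v w = 0)"

text \<open>Nondegenerate intervals (bounded or not) containing the initial time 0.\<close>

definition time_domain :: "real set \<Rightarrow> bool" where
  "time_domain T \<longleftrightarrow> is_interval T \<and> 0 \<in> T \<and> T \<noteq> {0}"

definition state_solution ::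
    "real^'n^'n \<Rightarrow> real^'m^'n \<Rightarrow> real set \<Rightarrow> (real \<Rightarrow> real^'m) \<Rightarrow> (real \<Rightarrow> real^'n) \<Rightarrow> bool" where
  "state_solution A F T u x \<longleftrightarrow>
     (\<forall>t\<in>T. (x has_vector_derivative (A *v x t + F *v u t)) (at t within T))"

definition iso_solution ::
    "real^'n^'n \<Rightarrow> real^'m^'n \<Rightarrow> real^'n^'p \<Rightarrow> real^'m^'p \<Rightarrow> real set \<Rightarrow>
     (real \<Rightarrow> real^'m) \<Rightarrow> (real \<Rightarrow> real^'n) \<Rightarrow> (real \<Rightarrow> real^'p) \<Rightarrow> bool" where
  "iso_solution A F C D T u x y \<longleftrightarrow>
     state_solution A F T u x \<and> (\<forall>t\<in>T. y t = C *v x t + D *v u t)"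

definition invariant_subspace :: "real^'n^'n \<Rightarrow> real^'m^'n \<Rightarrow> (real^'n) set \<Rightarrow> bool" where
  "invariant_subspace A F S \<longleftrightarrow>
     subspace S \<and>
     (\<forall>T u x. time_domain T \<longrightarrow> state_solution A F T u x \<longrightarrow> x 0 \<in> S \<longrightarrow> (\<forall>t\<in>T. x t \<in> S))"

text \<open>Real rational functions are elements of the field \<^typ>\<open>real poly fract\<close>. They are
  evaluated at complex points through the normalised, coprime representation
  \<^const>\<open>quot_of_fract\<close>, so removable singularities are cancelled. At a true pole the value is 0
  by \<open>x / 0 = 0\<close>; as the function is unbounded nearby, it is not analytic there.\<close>

definition rat_eval :: "real poly fract \<Rightarrow> complex \<Rightarrow> complex" where
  "rat_eval r s =
     poly (map_poly of_real (fst (quot_of_fract r))) s /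
     poly (map_poly of_real (snd (quot_of_fract r))) s"

definition rat_const_matrix :: "real^'n^'m \<Rightarrow> (real poly fract)^'n^'m" where
  "rat_const_matrix M = map_matrix (\<lambda>a. to_fract [:a:]) M"

text \<open>The indeterminate \<open>s\<close> of the field of rational functions.\<close>

definition rat_s :: "real poly fract" where
  "rat_s = to_fract [:0, 1:]"

text \<open>The inverse is taken over the field of rational functions, where \<open>sI - A\<close> is always
  invertible.\<close>

definition transfer_function ::
    "real^'n^'n \<Rightarrow> real^'m^'n \<Rightarrow> real^'n^'p \<Rightarrow> real^'m^'p \<Rightarrow> (real poly fract)^'m^'p" where
  "transfer_function A F C D =
     rat_const_matrix C ** matrix_inv (mat rat_s - rat_const_matrix A) ** rat_const_matrix F
       + rat_const_matrix D"

definition positive_real :: "(real poly fract)^'m^'m \<Rightarrow> bool" where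
  "positive_real H \<longleftrightarrow>
     (\<forall>i j. (\<lambda>s. rat_eval (H $ i $ j) s) analytic_on {s. 0 < Re s}) \<and>
     (\<forall>s. 0 < Re s \<longrightarrow>
        (let M = map_matrix (\<lambda>r. rat_eval r s) H
         in hermitian_pos_semidef (M + conj_transpose M)))"

definition pH_DAE_solution ::
    "real^'n^'n \<Rightarrow> real^'n^'n \<Rightarrow> real^'n^'n \<Rightarrow> real^'m^'n \<Rightarrow> real^'m^'n \<Rightarrow>
     real^'m^'m \<Rightarrow> real^'m^'m \<Rightarrow> real^'k^'n \<Rightarrow> real set \<Rightarrow>
     (real \<Rightarrow> real^'m) \<Rightarrow> (real \<Rightarrow> real^'n) \<Rightarrow> (real \<Rightarrow> real^'k) \<Rightarrow> (real \<Rightarrow> real^'m) \<Rightarrow> bool" where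
  "pH_DAE_solution J R Q B V N W G T u x l y \<longleftrightarrow>
     (\<forall>t\<in>T.
        (x has_vector_derivative
           (((J - R) ** Q) *v x t + (B - V) *v u t + G *v l t)) (at t within T) \<and>
        y t = (transpose (B + V) ** Q) *v x t + (N + W) *v u t \<and>
        0 = (transpose G ** Q) *v x t)"

definition lagrange_multiplier ::
    "real^'n^'n \<Rightarrow> real^'n^'n \<Rightarrow> real^'n^'n \<Rightarrow> real^'m^'n \<Rightarrow> real^'m^'n \<Rightarrow> real^'k^'n \<Rightarrow>
     real^'n \<Rightarrow> real^'m \<Rightarrow> real^'k" where
  "lagrange_multiplier J R Q B V G x u =
     - ((matrix_inv (transpose G ** Q ** G) ** transpose G ** Q ** (J - R) ** Q) *v x)
     - (matrix_inv (transpose G ** Q ** G) ** transpose G ** Q ** (B - V)) *v u"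

definition constraint_projection :: "real^'k^'n \<Rightarrow> real^'n^'n \<Rightarrow> real^'n^'n" where
  "constraint_projection G Q =
     mat 1 - G ** matrix_inv (transpose G ** Q ** G) ** transpose G ** Q"

end

(* With e = Q z, a solution of s z = P (J - R) Q z + P (B - V) v with s \<noteq> 0 satisfies
   G^T e = 0, so the projection P drops out of e^* P and
     Re s * z^* Q z = - e^* R e + Re (e^* (B - V) v).
   Adding the supplied power Re (v^* y) and using that [R, V; V^T, W] is positive semidefinite gives
   Re s * z^* Q z \<le> Re (v^* y) for the output y. For v = 0 and Q > 0 this forces z = 0, so sI - A is
   invertible on Re s > 0; for general v it says that the Hermitian part of the transfer matrix is
   nonnegative. Entries of the transfer matrix, formed over the field of rational functions, can be
   evaluated at s by Cramer's rule, as det (sI - A) does not vanish there. *)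

theory Submission
  imports Defs
begin

section \<open>Real matrices acting on complex vectors\<close>

abbreviation cmatrix :: "real^'n^'m \<Rightarrow> complex^'n^'m" where
  "cmatrix \<equiv> map_matrix complex_of_real"

lemma cmatrix_mult: "cmatrix (A ** B) = cmatrix A ** cmatrix B"
  by (simp add: vec_eq_iff matrix_matrix_mult_def)

lemma cmatrix_add: "cmatrix (A + B) = cmatrix A + cmatrix B"
  by (simp add: vec_eq_iff)

lemma cmatrix_diff: "cmatrix (A - B) = cmatrix A - cmatrix B"
  by (simp add: vec_eq_iff)

lemma cmatrix_mat: "cmatrix (mat a) = mat (complex_of_real a)"
  by (simp add: vec_eq_iff mat_def)

lemma cmatrix_0: "cmatrix 0 = 0"
  by (simp add: vec_eq_iff)

lemma matrix_vector_mult_mat: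
  fixes x :: "'a::semiring_1^'n"
  shows "mat c *v x = c *s x"
  by (simp add: vec_eq_iff matrix_vector_mult_def mat_def if_distrib[of "\<lambda>y. y * _"]
      cong: if_cong)

text \<open>On \<^typ>\<open>complex^'n\<close> the library's inner product is the real one, \<open>z \<bullet> w = Re (z\<^sup>* w)\<close>.\<close>

lemma Re_cnj_mult: "Re (cnj a * b) = a \<bullet> b"
  by (simp add: inner_complex_def)

lemma inner_conj_transpose:
  fixes M :: "complex^'n^'m"
  shows "z \<bullet> (M *v w) = (conj_transpose M *v z) \<bullet> w"
proof -
  have "z \<bullet> (M *v w) = (\<Sum>i\<in>UNIV. \<Sum>j\<in>UNIV. Re (cnj (z $ i) * (M $ i $ j * w $ j)))"
    by (simp only: inner_vec_def matrix_vector_mult_def vec_lambda_beta Re_cnj_mult[symmetric]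
        sum_distrib_left Re_sum)
  also have "\<dots> = (\<Sum>j\<in>UNIV. \<Sum>i\<in>UNIV. Re (cnj (cnj (M $ i $ j) * z $ i) * w $ j))"
    by (subst sum.swap) (simp add: algebra_simps)
  also have "\<dots> = (conj_transpose M *v z) \<bullet> w"
    by (simp only: inner_vec_def matrix_vector_mult_def vec_lambda_beta Re_cnj_mult[symmetric]
        conj_transpose_def sum_distrib_right cnj_sum Re_sum)
  finally show ?thesis .
qed

lemma inner_cmatrix_transpose: "z \<bullet> (cmatrix M *v w) = (cmatrix (transpose M) *v z) \<bullet> w"
proof -
  have "conj_transpose (cmatrix M) = cmatrix (transpose M)"
    by (simp add: vec_eq_iff conj_transpose_def transpose_def)
  then show ?thesis using inner_conj_transpose[of z "cmatrix M" w] by simp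
qed

text \<open>Real entries do not mix the real and imaginary parts of \<open>w\<close>. This carries
  facts about real quadratic forms over to complex vectors.\<close>

lemma inner_cmatrix:
  "z \<bullet> (cmatrix M *v w) =
     (\<chi> i. Re (z $ i)) \<bullet> (M *v (\<chi> j. Re (w $ j))) + (\<chi> i. Im (z $ i)) \<bullet> (M *v (\<chi> j. Im (w $ j)))"
  by (simp add: inner_vec_def matrix_vector_mult_def inner_complex_def sum.distrib)

lemma inner_matrix_transpose:
  fixes M :: "real^'n^'m"
  shows "x \<bullet> (M *v y) = (transpose M *v x) \<bullet> y"
  by (simp add: dot_lmul_matrix)

text \<open>A real skew form equals its own negative on the diagonal. Hence \<open>z^* J z\<close>
  is purely imaginary and its real part vanishes.\<close>

lemma inner_cmatrix_skew:
  assumes "transpose J = - J"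
  shows "z \<bullet> (cmatrix J *v z) = 0"
proof -
  have "x \<bullet> (J *v x) = 0" for x
  proof -
    have "x \<bullet> (J *v x) = (transpose J *v x) \<bullet> x"
      by (rule inner_matrix_transpose)
    also have "\<dots> = - (x \<bullet> (J *v x))"
      unfolding assms
      by (simp add: inner_vec_def matrix_vector_mult_def sum_negf sum_distrib_left algebra_simps)
    finally show ?thesis by simp
  qed
  then show ?thesis by (simp add: inner_cmatrix)
qed

text \<open>Since the conjugate of \<open>\<i>\<close> is \<open>- \<i>\<close>, multiplication by
  \<open>\<i>\<close> is skew-adjoint for the real inner product.\<close>

lemma inner_scale_imaginary_unit:
  fixes z :: "complex^'n"
  shows "(\<i> *s z) \<bullet> w = - (z \<bullet> (\<i> *s w))"
  by (simp add: inner_vec_def inner_complex_def sum_negf[symmetric])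

text \<open>For real symmetric \<open>Q\<close> the number \<open>z^* Q z\<close> is real, so the
  imaginary part of \<open>s\<close> contributes nothing to the real part of
  \<open>s z^* Q z\<close>.\<close>

lemma inner_scale_cmatrix_sym:
  assumes "transpose Q = Q"
  shows "z \<bullet> (s *s (cmatrix Q *v z)) = Re s * (z \<bullet> (cmatrix Q *v z))"
proof -
  have split: "s *s w = Re s *\<^sub>R w + Im s *\<^sub>R (\<i> *s w)" for w :: "complex^'a"
    by (simp add: vec_eq_iff complex_eq_iff)
  \<comment> \<open>Symmetry of \<open>Q\<close> and skewness of multiplication by
    \<open>\<i>\<close> turn this term into its own negative.\<close>
  have "z \<bullet> (\<i> *s (cmatrix Q *v z)) = (cmatrix Q *v z) \<bullet> (\<i> *s z)"
    using inner_cmatrix_transpose[of z Q "\<i> *s z"] assms by (simp add: vector_scalar_commute)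
  also have "\<dots> = - (z \<bullet> (\<i> *s (cmatrix Q *v z)))"
    by (metis inner_commute inner_scale_imaginary_unit)
  finally show ?thesis
    by (simp add: split inner_add_right)
qed

section \<open>Definiteness on complex vectors\<close>

text \<open>This is the block form evaluated at the stacked vector of \<open>x\<close> and
  \<open>u\<close>; the two off-diagonal blocks contribute equally, whence the factor 2.\<close>

lemma pos_semidef_block_matrixD:
  assumes "pos_semidef (block_matrix R V (transpose V) W)"
  shows "0 \<le> x \<bullet> (R *v x) + 2 * (x \<bullet> (V *v u)) + u \<bullet> (W *v u)"
proof -
  define w where "w = (\<chi> i. case i of Inl a \<Rightarrow> x $ a | Inr b \<Rightarrow> u $ b)"
  have sum_UNIV: "sum g (UNIV :: ('a + 'b) set) = (\<Sum>a\<in>UNIV. g (Inl a)) + (\<Sum>b\<in>UNIV. g (Inr b))"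
    for g :: "'a + 'b \<Rightarrow> real"
    by (simp add: UNIV_Plus_UNIV[symmetric] sum.Plus del: UNIV_Plus_UNIV)
  have "w \<bullet> (block_matrix R V (transpose V) W *v w) =
      x \<bullet> (R *v x) + x \<bullet> (V *v u) + (u \<bullet> (transpose V *v x) + u \<bullet> (W *v u))"
    by (simp add: w_def block_matrix_def inner_vec_def matrix_vector_mult_def sum_UNIV
        distrib_left sum.distrib)
  also have "u \<bullet> (transpose V *v x) = x \<bullet> (V *v u)"
    by (metis inner_matrix_transpose inner_commute)
  finally show ?thesis
    using assms unfolding pos_semidef_def by (metis add.assoc mult_2)
qed

lemma pos_semidef_block_cmatrixD:
  assumes "pos_semidef (block_matrix R V (transpose V) W)"
  shows "0 \<le> e \<bullet> (cmatrix R *v e) + 2 * (e \<bullet> (cmatrix V *v v)) + v \<bullet> (cmatrix W *v v)"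
proof -
  \<comment> \<open>The real inequality holds for the real parts and for the imaginary parts; the
    two instances are added.\<close>
  have "0 \<le> a + 2 * b + c \<Longrightarrow> 0 \<le> a' + 2 * b' + c' \<Longrightarrow> 0 \<le> (a + a') + 2 * (b + b') + (c + c')"
    for a b c a' b' c' :: real by simp
  then show ?thesis
    unfolding inner_cmatrix by (blast intro: pos_semidef_block_matrixD[OF assms])
qed

lemma pos_def_cmatrixD:
  assumes "pos_def Q" and "z \<noteq> 0"
  shows "0 < z \<bullet> (cmatrix Q *v z)"
proof -
  have pos: "x \<noteq> 0 \<Longrightarrow> 0 < x \<bullet> (Q *v x)" for x
    using assms(1) by (simp add: pos_def_def)
  then have nonneg: "0 \<le> x \<bullet> (Q *v x)" for x
    by (cases "x = 0") (auto intro: less_imp_le)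
  have "(\<chi> i. Re (z $ i)) \<noteq> 0 \<or> (\<chi> i. Im (z $ i)) \<noteq> 0"
    using assms(2) by (auto simp: vec_eq_iff complex_eq_iff)
  then show ?thesis
    unfolding inner_cmatrix using pos nonneg by (meson add_nonneg_pos add_pos_nonneg)
qed

section \<open>The dissipation inequality in the frequency domain\<close>

text \<open>The projection enters only through its shape \<open>mat 1 - G ** K\<close> and the
  annihilation \<open>(transpose G ** Q) ** P = 0\<close>. The bound serves twice later: with
  \<open>v = 0\<close> for invertibility of \<open>sI - A\<close>, and with arbitrary
  \<open>v\<close> for the Hermitian part.\<close>

lemma supply_rate_ge:
  fixes J R Q P :: "real^'n^'n" and B V :: "real^'m^'n" and G :: "real^'k^'n"
  assumes skew: "transpose J = - J" "transpose N = - N"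
    and psd: "pos_semidef (block_matrix R V (transpose V) W)"
    and Q: "transpose Q = Q"
    and P: "P = mat 1 - G ** K" and constr: "(transpose G ** Q) ** P = 0"
    and s: "s \<noteq> 0"
    and z: "s *s z = cmatrix (P ** (J - R) ** Q) *v z + cmatrix (P ** (B - V)) *v v"
  shows "Re s * (z \<bullet> (cmatrix Q *v z)) \<le>
    v \<bullet> (cmatrix (transpose (B + V) ** Q) *v z + cmatrix (N + W) *v v)"
proof -
  define e f where "e = cmatrix Q *v z"
    and "f = cmatrix (J - R) *v e + cmatrix (B - V) *v v"
  have sz: "s *s z = cmatrix P *v f"
    unfolding z f_def e_def
    by (simp add: cmatrix_mult matrix_vector_mul_assoc matrix_vector_right_distrib matrix_mul_assoc)
  \<comment> \<open>The right-hand side vanishes by \<open>constr\<close>. Dividing by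
    \<open>s\<close> then shows that \<open>z\<close> satisfies the algebraic constraint.\<close>
  have "s *s (cmatrix (transpose G ** Q) *v z) = cmatrix (transpose G ** Q ** P) *v f"
    by (simp only: vector_scalar_commute[symmetric] sz matrix_vector_mul_assoc cmatrix_mult)
  then have ker: "cmatrix (transpose G) *v e = 0"
    using s by (simp add: constr cmatrix_0 e_def cmatrix_mult matrix_vector_mul_assoc)
  have "Re s * (z \<bullet> (cmatrix Q *v z)) = z \<bullet> (cmatrix Q *v (s *s z))"
    by (simp only: vector_scalar_commute inner_scale_cmatrix_sym[OF Q])
  also have "\<dots> = e \<bullet> (cmatrix P *v f)"
    by (simp only: inner_cmatrix_transpose[of z Q] Q e_def[symmetric] sz)
  also have "\<dots> = e \<bullet> f - e \<bullet> (cmatrix G *v (cmatrix K *v f))"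
    by (simp only: P cmatrix_diff cmatrix_mat of_real_1 matrix_vector_mult_diff_rdistrib
        matrix_vector_mul_lid cmatrix_mult matrix_vector_mul_assoc[symmetric] inner_diff_right)
  \<comment> \<open>The correction lies in the range of \<open>G\<close>, which is orthogonal to
    \<open>e\<close> because \<open>G^T e = 0\<close>.\<close>
  also have "\<dots> = e \<bullet> f"
    by (simp add: inner_cmatrix_transpose[of e G] ker)
  also have "\<dots> = - (e \<bullet> (cmatrix R *v e)) + e \<bullet> (cmatrix B *v v) - e \<bullet> (cmatrix V *v v)"
    by (simp add: f_def cmatrix_diff matrix_vector_mult_diff_rdistrib inner_add_right
        inner_diff_right inner_cmatrix_skew[OF skew(1)])
  finally have lhs: "Re s * (z \<bullet> (cmatrix Q *v z)) =
      - (e \<bullet> (cmatrix R *v e)) + e \<bullet> (cmatrix B *v v) - e \<bullet> (cmatrix V *v v)" .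
  have "v \<bullet> (cmatrix (transpose (B + V)) *v e) = e \<bullet> (cmatrix (B + V) *v v)"
    by (metis inner_cmatrix_transpose inner_commute)
  then have "v \<bullet> (cmatrix (transpose (B + V) ** Q) *v z + cmatrix (N + W) *v v) =
      e \<bullet> (cmatrix B *v v) + e \<bullet> (cmatrix V *v v) + v \<bullet> (cmatrix W *v v)"
    by (simp add: e_def cmatrix_mult matrix_vector_mul_assoc[symmetric] cmatrix_add
        matrix_vector_mult_add_rdistrib inner_add_right inner_cmatrix_skew[OF skew(2)])
  \<comment> \<open>Right side minus left side is exactly the block form at \<open>e\<close> and
    \<open>v\<close>: both copies of the \<open>B\<close> term cancel and the two \<open>V\<close>
    terms add up.\<close>
  then show ?thesis
    using lhs pos_semidef_block_cmatrixD[OF psd, of e v] by linarith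
qed

text \<open>A matrix and its adjoint have the same real quadratic form, so that of the sum is twice
  the form of \<open>M\<close>.\<close>

lemma hermitian_pos_semidef_add_conj_transpose:
  assumes "\<And>v. 0 \<le> v \<bullet> (M *v v)"
  shows "hermitian_pos_semidef (M + conj_transpose M)"
proof -
  have adj: "conj_transpose (conj_transpose M) = M"
    by (simp add: vec_eq_iff conj_transpose_def)
  have "0 \<le> Re (\<Sum>i\<in>UNIV. cnj (v $ i) * ((M + conj_transpose M) *v v) $ i)" for v
  proof -
    have "Re (\<Sum>i\<in>UNIV. cnj (v $ i) * ((M + conj_transpose M) *v v) $ i) =
        v \<bullet> (M *v v) + v \<bullet> (conj_transpose M *v v)"
      by (simp only: Re_sum Re_cnj_mult inner_vec_def[symmetric] matrix_vector_mult_add_rdistrib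
          inner_add_right)
    also have "v \<bullet> (conj_transpose M *v v) = v \<bullet> (M *v v)"
      by (simp add: inner_conj_transpose[of v "conj_transpose M"] adj inner_commute)
    finally show ?thesis using assms[of v] by simp
  qed
  moreover have "conj_transpose (M + conj_transpose M) = M + conj_transpose M"
    by (simp add: vec_eq_iff conj_transpose_def add.commute)
  ultimately show ?thesis by (simp add: hermitian_pos_semidef_def)
qed

section \<open>Values of real rational functions at complex points\<close>

abbreviation cpoly :: "real poly \<Rightarrow> complex \<Rightarrow> complex" where
  "cpoly p \<equiv> poly (map_poly of_real p)"

lemma cpoly_add: "cpoly (p + q) s = cpoly p s + cpoly q s"
proof -
  have "map_poly of_real (p + q) = map_poly of_real p + (map_poly of_real q :: complex poly)"
    by (rule poly_eqI) (simp add: coeff_map_poly)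
  then show ?thesis by simp
qed

lemma cpoly_mult: "cpoly (p * q) s = cpoly p s * cpoly q s"
proof -
  have "map_poly of_real (p * q) = map_poly of_real p * (map_poly of_real q :: complex poly)"
    by (rule poly_eqI) (simp add: coeff_map_poly coeff_mult)
  then show ?thesis by simp
qed

text \<open>Unlike \<^const>\<open>rat_eval\<close>, which returns a junk value at a pole, this relation is compatible
  with the field operations: it holds only where the value is determined by a fraction whose
  denominator does not vanish at \<open>s\<close>.\<close>

definition rat_val :: "complex \<Rightarrow> real poly fract \<Rightarrow> complex \<Rightarrow> bool" where
  "rat_val s r c \<longleftrightarrow>
     (\<exists>p q. r = Fract p q \<and> cpoly q s \<noteq> 0 \<and> c = cpoly p s / cpoly q s)"

text \<open>One fraction whose denominator is nonzero at \<open>s\<close> suffices: the reduced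
  denominator divides that denominator, so it is nonzero at \<open>s\<close> as well, and
  cross-multiplication gives equal values.\<close>

lemma rat_val_imp_rat_eval:
  assumes "rat_val s r c"
  shows "cpoly (snd (quot_of_fract r)) s \<noteq> 0" and "rat_eval r s = c"
proof -
  obtain p q where pq: "r = Fract p q" "cpoly q s \<noteq> 0" "c = cpoly p s / cpoly q s"
    using assms unfolding rat_val_def by blast
  define n d where "n = fst (quot_of_fract r)" and "d = snd (quot_of_fract r)"
  have q: "q \<noteq> 0" using pq(2) by auto
  have d: "d \<noteq> 0" by (simp add: d_def)
  have "Fract n d = Fract p q"
    unfolding n_def d_def Fract_quot_of_fract by (fact pq(1))
  then have eq: "n * q = p * d"
    using q d by (simp add: eq_fract)
  have "coprime n d"
    by (simp add: n_def d_def coprime_quot_of_fract)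
  moreover have "d dvd n * q"
    by (simp add: eq)
  \<comment> \<open>The reduced denominator is coprime to the reduced numerator, so it must divide
    the other factor.\<close>
  ultimately have "d dvd q"
    by (simp add: coprime_commute coprime_dvd_mult_right_iff)
  then show dnz: "cpoly (snd (quot_of_fract r)) s \<noteq> 0"
    using pq(2) by (auto simp: d_def[symmetric] cpoly_mult)
  have "cpoly n s * cpoly q s = cpoly p s * cpoly d s"
    using arg_cong[OF eq, of "\<lambda>x. cpoly x s"] by (simp add: cpoly_mult)
  then show "rat_eval r s = c"
    using dnz pq(2) unfolding rat_eval_def pq(3) by (simp add: n_def d_def frac_eq_eq)
qed

text \<open>Unambiguous values allow identities between rational functions to be transferred to
  identities between complex numbers.\<close>

lemma rat_val_unique: "rat_val s r c \<Longrightarrow> rat_val s r c' \<Longrightarrow> c = c'"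
  using rat_val_imp_rat_eval(2) by blast

lemma rat_val_to_fract: "rat_val s (to_fract p) (cpoly p s)"
  unfolding rat_val_def to_fract_def by (intro exI[of _ p] exI[of _ 1]) auto

lemma rat_val_0: "rat_val s 0 0" and rat_val_1: "rat_val s 1 1"
  using rat_val_to_fract[of s 0] rat_val_to_fract[of s 1] by simp_all

lemma rat_val_add:
  assumes "rat_val s r c" "rat_val s r' c'"
  shows "rat_val s (r + r') (c + c')"
proof -
  obtain p q p' q' where
    "r = Fract p q" "cpoly q s \<noteq> 0" "c = cpoly p s / cpoly q s"
    "r' = Fract p' q'" "cpoly q' s \<noteq> 0" "c' = cpoly p' s / cpoly q' s"
    using assms unfolding rat_val_def by blast
  moreover from this have "q \<noteq> 0" "q' \<noteq> 0" by auto
  ultimately show ?thesis unfolding rat_val_def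
    by (intro exI[of _ "p * q' + p' * q"] exI[of _ "q * q'"])
      (simp add: cpoly_add cpoly_mult add_frac_eq)
qed

lemma rat_val_mult:
  assumes "rat_val s r c" "rat_val s r' c'"
  shows "rat_val s (r * r') (c * c')"
proof -
  obtain p q p' q' where
    "r = Fract p q" "cpoly q s \<noteq> 0" "c = cpoly p s / cpoly q s"
    "r' = Fract p' q'" "cpoly q' s \<noteq> 0" "c' = cpoly p' s / cpoly q' s"
    using assms unfolding rat_val_def by blast
  then show ?thesis unfolding rat_val_def
    by (intro exI[of _ "p * p'"] exI[of _ "q * q'"]) (simp add: cpoly_mult)
qed

lemma rat_val_inverse:
  assumes "rat_val s r c" "c \<noteq> 0"
  shows "rat_val s (inverse r) (inverse c)"
proof -
  obtain p q where "r = Fract p q" "cpoly q s \<noteq> 0" "c = cpoly p s / cpoly q s"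
    using assms unfolding rat_val_def by blast
  then show ?thesis using assms(2) unfolding rat_val_def
    by (intro exI[of _ q] exI[of _ p]) simp
qed

lemma rat_val_uminus:
  assumes "rat_val s r c"
  shows "rat_val s (- r) (- c)"
proof -
  have "cpoly (- p) s = - cpoly p s" for p
    using cpoly_add[of "- p" p s] by (simp add: eq_neg_iff_add_eq_0)
  then show ?thesis
    using assms unfolding rat_val_def by (metis minus_divide_left minus_fract)
qed

text \<open>Provides the values of the permutation signs in the Leibniz formula for
  determinants.\<close>

lemma rat_val_of_int: "rat_val s (of_int k) (of_int k)"
proof -
  have "rat_val s (of_nat n) (of_nat n)" for n
    by (induction n) (simp_all add: rat_val_0 rat_val_1 rat_val_add)
  then show ?thesis
    by (cases k rule: int_cases2) (simp_all add: rat_val_uminus)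
qed

lemma rat_val_diff:
  "rat_val s r c \<Longrightarrow> rat_val s r' c' \<Longrightarrow> rat_val s (r - r') (c - c')"
  using rat_val_add[OF _ rat_val_uminus] by fastforce

lemma rat_val_sum:
  "(\<And>i. i \<in> I \<Longrightarrow> rat_val s (f i) (g i)) \<Longrightarrow> rat_val s (sum f I) (sum g I)"
  by (induction I rule: infinite_finite_induct) (auto intro: rat_val_0 rat_val_add)

lemma rat_val_prod:
  "(\<And>i. i \<in> I \<Longrightarrow> rat_val s (f i) (g i)) \<Longrightarrow> rat_val s (prod f I) (prod g I)"
  by (induction I rule: infinite_finite_induct) (auto intro: rat_val_1 rat_val_mult)

section \<open>Evaluation of rational matrices and of the transfer function\<close>

definition rat_val_matrix ::
    "complex \<Rightarrow> (real poly fract)^'n^'m \<Rightarrow> complex^'n^'m \<Rightarrow> bool" where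
  "rat_val_matrix s M M' \<longleftrightarrow> (\<forall>i j. rat_val s (M $ i $ j) (M' $ i $ j))"

lemma rat_val_det:
  "rat_val_matrix s M M' \<Longrightarrow> rat_val s (det M) (det M')"
  unfolding det_def rat_val_matrix_def
  by (intro rat_val_sum rat_val_mult rat_val_of_int rat_val_prod) auto

lemma rat_val_matrix_add:
  "rat_val_matrix s M M' \<Longrightarrow> rat_val_matrix s L L' \<Longrightarrow> rat_val_matrix s (M + L) (M' + L')"
  by (simp add: rat_val_matrix_def rat_val_add)

lemma rat_val_matrix_diff:
  "rat_val_matrix s M M' \<Longrightarrow> rat_val_matrix s L L' \<Longrightarrow> rat_val_matrix s (M - L) (M' - L')"
  by (simp add: rat_val_matrix_def rat_val_diff)

lemma rat_val_matrix_mult: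
  "rat_val_matrix s M M' \<Longrightarrow> rat_val_matrix s L L' \<Longrightarrow> rat_val_matrix s (M ** L) (M' ** L')"
  by (simp add: rat_val_matrix_def matrix_matrix_mult_def rat_val_sum rat_val_mult)

lemma rat_val_matrix_const: "rat_val_matrix s (rat_const_matrix M) (cmatrix M)"
  unfolding rat_val_matrix_def rat_const_matrix_def
proof (intro allI)
  fix i j
  show "rat_val s (map_matrix (\<lambda>a. to_fract [:a:]) M $ i $ j) (cmatrix M $ i $ j)"
    using rat_val_to_fract[of s "[:M $ i $ j:]"] by (simp add: map_poly_pCons)
qed

lemma rat_val_matrix_s: "rat_val_matrix s (mat rat_s) (mat s)"
  using rat_val_to_fract[of s "[:0, 1:]"]
  by (simp add: rat_val_matrix_def mat_def rat_val_0 rat_s_def map_poly_pCons)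

lemma matrix_inv_mult:
  fixes M :: "'a::semiring_1^'n^'n"
  assumes "invertible M"
  shows "M ** matrix_inv M = mat 1" and "matrix_inv M ** M = mat 1"
  using assms someI_ex[of "\<lambda>A'. M ** A' = mat 1 \<and> A' ** M = mat 1"]
  by (auto simp: invertible_def matrix_inv_def)

text \<open>By Cramer's rule each entry of the inverse is a determinant divided by
  \<open>det M\<close>, whose value \<open>det M'\<close> at \<open>s\<close> is nonzero. Evaluating
  \<open>M ** matrix_inv M = mat 1\<close> then identifies the values as a right inverse of
  \<open>M'\<close>.\<close>

lemma rat_val_matrix_inv:
  fixes M :: "(real poly fract)^'n^'n"
  assumes M: "rat_val_matrix s M M'" and inv: "invertible M'"
  shows "\<exists>X. rat_val_matrix s (matrix_inv M) X \<and> M' ** X = mat 1"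
proof -
  have det': "det M' \<noteq> 0" using inv by (simp add: invertible_det_nz)
  \<comment> \<open>If \<open>det M\<close> were the zero function, its value \<open>det M'\<close>
    at \<open>s\<close> would be 0.\<close>
  have det: "det M \<noteq> 0"
    using rat_val_unique[OF rat_val_det[OF M]] rat_val_0 det' by auto
  then have "invertible M" by (simp add: invertible_det_nz)
  then have MX: "M ** matrix_inv M = mat 1"
    by (rule matrix_inv_mult)
  have "\<exists>c. rat_val s (matrix_inv M $ i $ j) c" for i j
  proof -
    \<comment> \<open>Column \<open>j\<close> of the inverse solves the linear system whose
      right-hand side is the \<open>j\<close>-th unit vector.\<close>
    have "M *v column j (matrix_inv M) = column j (mat 1)"
      unfolding MX[symmetric]
      by (simp add: vec_eq_iff column_def matrix_matrix_mult_def matrix_vector_mult_def)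
    then have "column j (matrix_inv M) =
        (\<chi> k. det (\<chi> i' l. if l = k then column j (mat 1) $ i' else M $ i' $ l) / det M)"
      using cramer[OF det] by blast
    from arg_cong[OF this, of "\<lambda>x. x $ i"] have eq: "matrix_inv M $ i $ j =
        det (\<chi> i' l. if l = i then column j (mat 1) $ i' else M $ i' $ l) * inverse (det M)"
      by (simp only: column_def vec_lambda_beta divide_inverse)
    have "rat_val_matrix s (\<chi> i' l. if l = i then column j (mat 1) $ i' else M $ i' $ l)
        (\<chi> i' l. if l = i then column j (mat 1) $ i' else M' $ i' $ l)"
      using M by (auto simp: rat_val_matrix_def column_def mat_def rat_val_0 rat_val_1)
    then show ?thesis
      unfolding eq using rat_val_mult[OF rat_val_det rat_val_inverse[OF rat_val_det[OF M] det']]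
      by blast
  qed
  then obtain x where x: "\<And>i j. rat_val s (matrix_inv M $ i $ j) (x i j)"
    by metis
  define X where "X = (\<chi> i j. x i j)"
  have X: "rat_val_matrix s (matrix_inv M) X"
    by (simp add: rat_val_matrix_def X_def x)
  have "rat_val_matrix s (mat 1) (M' ** X)"
    using rat_val_matrix_mult[OF M X] by (simp add: MX)
  moreover have "rat_val_matrix s (mat 1) (mat 1)"
    by (simp add: rat_val_matrix_def mat_def rat_val_0 rat_val_1)
  ultimately have "(M' ** X) $ i $ j = mat 1 $ i $ j" for i j
    unfolding rat_val_matrix_def using rat_val_unique by blast
  then have "M' ** X = mat 1"
    by (simp only: vec_eq_iff) blast
  with X show ?thesis by blast
qed

text \<open>Replaces the inverse over the field of rational functions by the complex resolvent
  \<open>X\<close> at \<open>s\<close>, so that estimates can be made with complex vectors.\<close>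

lemma rat_val_transfer_function:
  assumes "invertible (mat s - cmatrix A)"
  shows "\<exists>X. (mat s - cmatrix A) ** X = mat 1 \<and>
    rat_val_matrix s (transfer_function A F C D) (cmatrix C ** X ** cmatrix F + cmatrix D)"
  using rat_val_matrix_inv[OF rat_val_matrix_diff[OF rat_val_matrix_s rat_val_matrix_const] assms]
  unfolding transfer_function_def
  by (blast intro: rat_val_matrix_add rat_val_matrix_mult rat_val_matrix_const)

lemma cpoly_analytic: "cpoly p analytic_on S"
proof -
  have "cpoly p holomorphic_on UNIV"
    unfolding holomorphic_on_def field_differentiable_def
    using poly_DERIV has_field_derivative_at_within by blast
  then show ?thesis
    using analytic_on_open[of UNIV] analytic_on_subset by blast
qed

text \<open>Having a value at every point of \<open>S\<close> means that the reduced denominator has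
  no zero there, which leaves a quotient of polynomials.\<close>

lemma rat_eval_analytic:
  assumes "\<And>s. s \<in> S \<Longrightarrow> \<exists>c. rat_val s r c"
  shows "(\<lambda>s. rat_eval r s) analytic_on S"
  unfolding rat_eval_def
  using assms rat_val_imp_rat_eval(1) by (intro analytic_on_divide cpoly_analytic) blast

section \<open>The constraint projection and the Lagrange multiplier\<close>

lemma constraint_projection_vector:
  "constraint_projection G Q *v x =
     x - G *v (matrix_inv (transpose G ** Q ** G) *v ((transpose G ** Q) *v x))"
  by (simp add: constraint_projection_def matrix_vector_mult_diff_rdistrib
      matrix_vector_mul_assoc matrix_mul_assoc)

lemma constraint_constraint_projection:
  assumes "invertible (transpose G ** Q ** G)"
  shows "(transpose G ** Q) ** constraint_projection G Q = 0"
proof -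
  have "(transpose G ** Q) *v (constraint_projection G Q *v x) = 0" for x
  proof -
    \<comment> \<open>\<open>G^T Q G\<close> meets its inverse here, so the subtracted term has the
      same image under \<open>G^T Q\<close> as \<open>x\<close> itself.\<close>
    have "(transpose G ** Q) *v (G *v (matrix_inv (transpose G ** Q ** G) *v w)) = w" for w
      by (simp only: matrix_vector_mul_assoc matrix_mul_assoc matrix_inv_mult(1)[OF assms]
          matrix_vector_mul_lid)
    then show ?thesis
      by (simp only: constraint_projection_vector matrix_vector_mult_diff_distrib diff_self)
  qed
  then show ?thesis
    by (simp only: matrix_eq matrix_vector_mul_assoc matrix_vector_mult_0) simp
qed

lemma lagrange_multiplier_eq:
  "lagrange_multiplier J R Q B V G \<xi> \<upsilon> =
     - (matrix_inv (transpose G ** Q ** G) *v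
         ((transpose G ** Q) *v (((J - R) ** Q) *v \<xi> + (B - V) *v \<upsilon>)))"
  by (simp add: lagrange_multiplier_def matrix_vector_right_distrib matrix_vector_mul_assoc
      matrix_mul_assoc)

lemma matrix_vector_mult_uminus:
  fixes A :: "'a::ring_1^'n^'m"
  shows "A *v (- x) = - (A *v x)"
  using matrix_vector_mult_diff_distrib[of A 0 x] by simp

text \<open>The differentiated constraint is affine in \<open>\<mu>\<close> with linear part
  \<open>G^T Q G\<close>, so invertibility of that matrix gives exactly one solution.\<close>

lemma lagrange_multiplier_iff:
  fixes G :: "real^'k^'n"
  assumes "invertible (transpose G ** Q ** G)"
  shows "(transpose G ** Q) *v (((J - R) ** Q) *v \<xi> + (B - V) *v \<upsilon> + G *v \<mu>) = 0 \<longleftrightarrow>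
    \<mu> = lagrange_multiplier J R Q B V G \<xi> \<upsilon>"
proof -
  define M where "M = transpose G ** Q ** G"
  define c where "c = (transpose G ** Q) *v (((J - R) ** Q) *v \<xi> + (B - V) *v \<upsilon>)"
  note inv = matrix_inv_mult[OF assms, folded M_def]
  have "(transpose G ** Q) *v (((J - R) ** Q) *v \<xi> + (B - V) *v \<upsilon> + G *v \<mu>) = c + M *v \<mu>"
    by (simp only: matrix_vector_right_distrib c_def M_def matrix_vector_mul_assoc)
  moreover have "c + M *v \<mu> = 0 \<longleftrightarrow> \<mu> = - (matrix_inv M *v c)"
  proof
    assume "c + M *v \<mu> = 0"
    then have "M *v \<mu> = - c" by (simp add: add_eq_0_iff)
    then have "matrix_inv M *v (M *v \<mu>) = - (matrix_inv M *v c)"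
      by (simp add: matrix_vector_mult_uminus)
    then show "\<mu> = - (matrix_inv M *v c)"
      by (simp add: matrix_vector_mul_assoc inv)
  next
    assume "\<mu> = - (matrix_inv M *v c)"
    then show "c + M *v \<mu> = 0"
      by (simp add: matrix_vector_mult_uminus matrix_vector_mul_assoc inv)
  qed
  ultimately show ?thesis
    by (simp add: lagrange_multiplier_eq M_def c_def)
qed

text \<open>The constraint force \<open>G \<lambda>\<close> is the negative of the term that the
  projection subtracts from the unconstrained velocity.\<close>

lemma lagrange_multiplier_substitute:
  "((J - R) ** Q) *v \<xi> + (B - V) *v \<upsilon> + G *v lagrange_multiplier J R Q B V G \<xi> \<upsilon> =
     (constraint_projection G Q ** (J - R) ** Q) *v \<xi> + (constraint_projection G Q ** (B - V)) *v \<upsilon>"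
proof -
  have "(constraint_projection G Q ** (J - R) ** Q) *v \<xi> + (constraint_projection G Q ** (B - V)) *v \<upsilon> =
      constraint_projection G Q *v (((J - R) ** Q) *v \<xi> + (B - V) *v \<upsilon>)"
    by (simp add: matrix_vector_right_distrib matrix_vector_mul_assoc matrix_mul_assoc)
  then show ?thesis
    by (simp add: lagrange_multiplier_eq constraint_projection_vector matrix_vector_mult_uminus)
qed

section \<open>Solutions of the constrained system\<close>

text \<open>A connected set with more than one point has no isolated points. Derivatives within
  \<open>T\<close> are therefore unique, also at endpoints.\<close>

lemma time_domain_at_within_nontrivial:
  assumes "time_domain T" and "t \<in> T"
  shows "at t within T \<noteq> bot"
proof -
  have "connected T"
    using assms(1) by (simp add: time_domain_def is_interval_connected)
  moreover have "\<nexists>a. T = {a}"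
    using assms(1) by (auto simp: time_domain_def)
  ultimately show ?thesis
    using assms(2) by (simp add: connected_imp_perfect trivial_limit_within)
qed

lemma has_vector_derivative_matrix_vector_mult:
  fixes M :: "real^'n^'m"
  assumes "(x has_vector_derivative x') F"
  shows "((\<lambda>t. M *v x t) has_vector_derivative M *v x') F"
  using bounded_linear.has_vector_derivative[OF matrix_vector_mul_bounded_linear assms] .

text \<open>On \<open>T\<close> the function \<open>G^T Q x\<close> has two derivatives, one from
  the differential equation and one from being identically zero; uniqueness equates them.\<close>

lemma pH_DAE_solution_hidden_constraint:
  assumes "time_domain T" and sol: "pH_DAE_solution J R Q B V N W G T u x l y" and t: "t \<in> T"
  shows "(transpose G ** Q) *v (((J - R) ** Q) *v x t + (B - V) *v u t + G *v l t) = 0"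
proof (rule vector_derivative_unique_within[OF time_domain_at_within_nontrivial[OF assms(1) t]])
  show "((\<lambda>t. (transpose G ** Q) *v x t) has_vector_derivative
      (transpose G ** Q) *v (((J - R) ** Q) *v x t + (B - V) *v u t + G *v l t)) (at t within T)"
    using sol t unfolding pH_DAE_solution_def
    by (intro has_vector_derivative_matrix_vector_mult) blast
  have "((\<lambda>t. 0) has_vector_derivative 0) (at t within T)"
    by (rule has_vector_derivative_const)
  then show "((\<lambda>t. (transpose G ** Q) *v x t) has_vector_derivative 0) (at t within T)"
    by (rule has_vector_derivative_transform[OF t, rotated])
      (use sol in \<open>simp add: pH_DAE_solution_def\<close>)
qed

lemma pH_DAE_solution_imp_iso_solution:
  assumes "invertible (transpose G ** Q ** G)"
    and "time_domain T" and sol: "pH_DAE_solution J R Q B V N W G T u x l y"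
  shows "iso_solution (constraint_projection G Q ** (J - R) ** Q)
    (constraint_projection G Q ** (B - V)) (transpose (B + V) ** Q) (N + W) T u x y"
proof -
  \<comment> \<open>The hidden constraint forces \<open>l t\<close> to be the multiplier, whose
    substitution yields the projected velocity.\<close>
  have "(constraint_projection G Q ** (J - R) ** Q) *v x t + (constraint_projection G Q ** (B - V)) *v u t =
      ((J - R) ** Q) *v x t + (B - V) *v u t + G *v l t" if "t \<in> T" for t
    using pH_DAE_solution_hidden_constraint[OF assms(2) sol that]
    by (simp only: lagrange_multiplier_iff[OF assms(1)] lagrange_multiplier_substitute[symmetric])
  then show ?thesis
    using sol by (auto simp: iso_solution_def state_solution_def pH_DAE_solution_def)
qed

section \<open>Orthogonality of the projection and invariance of the constraint subspace\<close>

lemma Q_orthogonal_projection_constraint_projection: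
  assumes inv: "invertible (transpose G ** Q ** G)" and Q: "transpose Q = Q"
  shows "Q_orthogonal_projection Q (constraint_projection G Q) (mat_ker (transpose G ** Q))"
proof -
  let ?E = "transpose G ** Q" and ?P = "constraint_projection G Q"
  have EP: "?E *v (?P *v x) = 0" for x
    by (simp add: matrix_vector_mul_assoc constraint_constraint_projection[OF inv])
  have P_id: "?P *v x = x" if "?E *v x = 0" for x
    using that by (simp add: constraint_projection_vector)
  have "?P ** ?P = ?P"
    using P_id[OF EP] by (simp add: matrix_eq matrix_vector_mul_assoc[symmetric])
  moreover have "range (\<lambda>x. ?P *v x) = mat_ker ?E"
    using P_id EP by (auto simp: mat_ker_def) (metis rangeI)
  moreover have "Q_inner Q v w = 0" if v: "v \<in> mat_ker ?E" and w: "w \<in> mat_ker ?P" for v w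
  proof -
    define g where "g = matrix_inv (transpose G ** Q ** G) *v (?E *v w)"
    \<comment> \<open>The kernel of the projection lies in the range of \<open>G\<close>, so pairing
      with \<open>v\<close> through \<open>Q\<close> produces the factor
      \<open>G^T Q v = 0\<close>.\<close>
    have "w = G *v g"
      using w by (simp add: mat_ker_def constraint_projection_vector g_def)
    then have "Q_inner Q v w = (?E *v v) \<bullet> g"
      using inner_matrix_transpose[of v Q "G *v g"] inner_matrix_transpose[of "Q *v v" G g] Q
      by (simp add: Q_inner_def matrix_vector_mul_assoc)
    then show ?thesis using v by (simp add: mat_ker_def)
  qed
  ultimately show ?thesis
    by (simp add: Q_orthogonal_projection_def projection_onto_def)
qed

text \<open>Whatever the input, \<open>E x\<close> has zero derivative along solutions. On an
  interval it keeps its value at time 0, which is 0.\<close>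

lemma invariant_subspace_mat_ker:
  fixes E :: "real^'n^'k"
  assumes "E ** A = 0" and "E ** F = 0"
  shows "invariant_subspace A F (mat_ker E)"
  unfolding invariant_subspace_def
proof (intro conjI allI impI ballI)
  show "subspace (mat_ker E)"
    by (simp add: subspace_def mat_ker_def matrix_vector_right_distrib
        scaleR_matrix_vector_assoc[symmetric] matrix_vector_mult_scaleR)
  fix T u and x :: "real \<Rightarrow> real^'n" and t
  assume T: "time_domain T" and x: "state_solution A F T u x"
    and x0: "x 0 \<in> mat_ker E" and t: "t \<in> T"
  have "((\<lambda>t. E *v x t) has_derivative (\<lambda>h. 0)) (at t within T)" if "t \<in> T" for t
  proof -
    have "E *v (A *v x t + F *v u t) = 0"
      by (simp add: matrix_vector_right_distrib matrix_vector_mul_assoc assms)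
    then have "((\<lambda>t. E *v x t) has_vector_derivative 0) (at t within T)"
      using has_vector_derivative_matrix_vector_mult[of x "A *v x t + F *v u t" "at t within T" E]
        x that by (simp add: state_solution_def)
    then show ?thesis by (simp add: has_vector_derivative_def)
  qed
  then obtain c where "\<And>t. t \<in> T \<Longrightarrow> E *v x t = c"
    using has_derivative_zero_constant[of T "\<lambda>t. E *v x t"] T
    by (auto simp: time_domain_def is_interval_convex)
  then show "x t \<in> mat_ker E"
    using x0 t T by (simp add: mat_ker_def time_domain_def)
qed

section \<open>Positive realness for positive definite \<open>Q\<close>\<close>

lemma invertible_if_ker_trivial:
  fixes M :: "'a::field^'n^'n"
  assumes "\<And>x. M *v x = 0 \<Longrightarrow> x = 0"
  shows "invertible M"
  using assms by (simp add: invertible_left_inverse matrix_left_invertible_ker)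

text \<open>The quadratic form of \<open>G^T Q G\<close> at \<open>v\<close> is that of
  \<open>Q\<close> at \<open>G v\<close>. It vanishes only if \<open>G v = 0\<close>, and full
  column rank then gives \<open>v = 0\<close>.\<close>

lemma pos_def_imp_invertible_congruence:
  fixes G :: "real^'k^'n"
  assumes "pos_def Q" and "rank G = CARD('k)"
  shows "invertible (transpose G ** Q ** G)"
proof (rule invertible_if_ker_trivial)
  fix v assume "(transpose G ** Q ** G) *v v = 0"
  then have "v \<bullet> (transpose G *v (Q *v (G *v v))) = 0"
    by (simp add: matrix_vector_mul_assoc matrix_mul_assoc)
  then have "(G *v v) \<bullet> (Q *v (G *v v)) = 0"
    by (simp only: inner_matrix_transpose transpose_transpose)
  then have "G *v v = 0"
    using assms(1) unfolding pos_def_def by (metis less_irrefl)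
  then show "v = 0"
    using assms(2) by (simp add: full_rank_injective vec.inj_iff_eq_0)
qed

lemma positive_real_constrained_transfer_function:
  fixes J R Q P :: "real^'n^'n" and B V :: "real^'m^'n" and G :: "real^'k^'n"
  assumes skew: "transpose J = - J" "transpose N = - N"
    and psd: "pos_semidef (block_matrix R V (transpose V) W)"
    and Q: "pos_def Q"
    and P: "P = mat 1 - G ** K" and constr: "(transpose G ** Q) ** P = 0"
  shows "positive_real
    (transfer_function (P ** (J - R) ** Q) (P ** (B - V)) (transpose (B + V) ** Q) (N + W))"
proof -
  define A F C D where "A = P ** (J - R) ** Q" and "F = P ** (B - V)"
    and "C = transpose (B + V) ** Q" and "D = N + W"
  define H where "H = transfer_function A F C D"
  have Qsym: "transpose Q = Q"
    using Q by (simp add: pos_def_def)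
  have supply_ge: "Re s * (z \<bullet> (cmatrix Q *v z)) \<le> v \<bullet> (cmatrix C *v z + cmatrix D *v v)"
    if "0 < Re s" and "(mat s - cmatrix A) *v z = cmatrix F *v v" for s z v
  proof -
    have "s \<noteq> 0" using that(1) by auto
    moreover have "s *s z = cmatrix A *v z + cmatrix F *v v"
      using that(2) by (simp add: matrix_vector_mult_diff_rdistrib matrix_vector_mult_mat algebra_simps)
    ultimately show ?thesis
      unfolding A_def F_def C_def D_def by (rule supply_rate_ge[OF skew psd Qsym P constr])
  qed
  have inv: "invertible (mat s - cmatrix A)" if s: "0 < Re s" for s
  proof (rule invertible_if_ker_trivial)
    fix z assume "(mat s - cmatrix A) *v z = 0"
    \<comment> \<open>With zero input the supplied power is 0, so a kernel vector has nonpositive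
      energy.\<close>
    then have "Re s * (z \<bullet> (cmatrix Q *v z)) \<le> 0"
      using supply_ge[OF s, of z 0] by simp
    then show "z = 0"
      using pos_def_cmatrixD[OF Q, of z] mult_pos_pos[OF s] by (meson not_le)
  qed
  \<comment> \<open>Invertibility of \<open>sI - A\<close> gives every entry a value at each point
    of the open right half-plane, which excludes poles.\<close>
  have analytic: "(\<lambda>s. rat_eval (H $ i $ j) s) analytic_on {s. 0 < Re s}" for i j
    by (rule rat_eval_analytic)
      (use rat_val_transfer_function[OF inv] in \<open>fastforce simp: rat_val_matrix_def H_def\<close>)
  have herm: "hermitian_pos_semidef (M + conj_transpose M)"
    if s: "0 < Re s" and M: "M = map_matrix (\<lambda>r. rat_eval r s) H" for s M
  proof (rule hermitian_pos_semidef_add_conj_transpose)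
    fix v
    obtain X where X: "(mat s - cmatrix A) ** X = mat 1"
      and H: "rat_val_matrix s H (cmatrix C ** X ** cmatrix F + cmatrix D)"
      using rat_val_transfer_function[OF inv[OF s]] unfolding H_def by blast
    have M: "M = cmatrix C ** X ** cmatrix F + cmatrix D"
      using H rat_val_imp_rat_eval(2) by (auto simp: M vec_eq_iff rat_val_matrix_def)
    \<comment> \<open>The state response to \<open>v\<close>, for which the output is
      \<open>M v\<close> and the supplied power is the quadratic form of \<open>M\<close>.\<close>
    define z where "z = X *v (cmatrix F *v v)"
    have "(mat s - cmatrix A) *v z = cmatrix F *v v"
      by (simp only: z_def matrix_vector_mul_assoc matrix_mul_assoc X matrix_mul_lid)
    from supply_ge[OF s this]
    have "Re s * (z \<bullet> (cmatrix Q *v z)) \<le> v \<bullet> (M *v v)"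
      by (simp only: M z_def matrix_vector_mult_add_rdistrib matrix_vector_mul_assoc matrix_mul_assoc)
    moreover have "0 \<le> Re s * (z \<bullet> (cmatrix Q *v z))"
      using s pos_def_cmatrixD[OF Q, of z] by (cases "z = 0") auto
    ultimately show "0 \<le> v \<bullet> (M *v v)" by simp
  qed
  show ?thesis
    using analytic herm unfolding positive_real_def H_def A_def F_def C_def D_def Let_def by blast
qed

section \<open>Elimination of the multiplier and properties of the reduced system\<close>

text \<open>The formulas presuppose that \<open>G^T Q G\<close> is invertible. For indefinite
  \<open>Q\<close> this can fail, as for \<open>Q = diag(1, -1)\<close> and
  \<open>G = (1, 1)^T\<close>, so it is the premise of the first conjunct; for
  \<open>pos_def Q\<close> it is proved.\<close>

theorem mainTheorem4:
  fixes J R Q :: "real^'n^'n"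
    and B V :: "real^'m^'n"
    and N W :: "real^'m^'m"
    and G :: "real^'k^'n"
  assumes "transpose J = - J" and "transpose N = - N"
    and "transpose R = R" and "transpose W = W"
    and "pos_semidef (block_matrix R V (transpose V) W)"
    and "transpose Q = Q"
    and "invertible Q"
    and "rank G = CARD('k)"
  shows
    "(invertible (transpose G ** Q ** G) \<longrightarrow>
        (\<forall>T u x l y. time_domain T \<longrightarrow> pH_DAE_solution J R Q B V N W G T u x l y \<longrightarrow>
           (\<forall>t\<in>T.
              (transpose G ** Q) *v (((J - R) ** Q) *v x t + (B - V) *v u t + G *v l t) = 0 \<and>
              l t = lagrange_multiplier J R Q B V G (x t) (u t)) \<and>
           iso_solution (constraint_projection G Q ** (J - R) ** Q)
             (constraint_projection G Q ** (B - V))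
             (transpose (B + V) ** Q) (N + W) T u x y) \<and>
        (\<forall>\<xi> \<upsilon>.
           (\<forall>\<mu>. (transpose G ** Q) *v (((J - R) ** Q) *v \<xi> + (B - V) *v \<upsilon> + G *v \<mu>) = 0 \<longleftrightarrow>
                \<mu> = lagrange_multiplier J R Q B V G \<xi> \<upsilon>) \<and>
           ((J - R) ** Q) *v \<xi> + (B - V) *v \<upsilon> + G *v lagrange_multiplier J R Q B V G \<xi> \<upsilon> =
             (constraint_projection G Q ** (J - R) ** Q) *v \<xi>
               + (constraint_projection G Q ** (B - V)) *v \<upsilon>) \<and>
        Q_orthogonal_projection Q (constraint_projection G Q) (mat_ker (transpose G ** Q)) \<and>
        invariant_subspace (constraint_projection G Q ** (J - R) ** Q)
          (constraint_projection G Q ** (B - V)) (mat_ker (transpose G ** Q)) \<and>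
        transfer_function (constraint_projection G Q ** (J - R) ** Q)
            (constraint_projection G Q ** (B - V)) (transpose (B + V) ** Q) (N + W) =
          rat_const_matrix (transpose (B + V) ** Q)
            ** matrix_inv (mat rat_s - rat_const_matrix (constraint_projection G Q ** (J - R) ** Q))
            ** rat_const_matrix (constraint_projection G Q ** (B - V))
          + rat_const_matrix (N + W)) \<and>
     (pos_def Q \<longrightarrow>
        invertible (transpose G ** Q ** G) \<and>
        positive_real
          (transfer_function (constraint_projection G Q ** (J - R) ** Q)
             (constraint_projection G Q ** (B - V)) (transpose (B + V) ** Q) (N + W)))"
proof (intro conjI impI)
  assume inv: "invertible (transpose G ** Q ** G)"
  note constr = constraint_constraint_projection[OF inv]
  show "\<forall>T u x l y. time_domain T \<longrightarrow> pH_DAE_solution J R Q B V N W G T u x l y \<longrightarrow>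
      (\<forall>t\<in>T.
         (transpose G ** Q) *v (((J - R) ** Q) *v x t + (B - V) *v u t + G *v l t) = 0 \<and>
         l t = lagrange_multiplier J R Q B V G (x t) (u t)) \<and>
      iso_solution (constraint_projection G Q ** (J - R) ** Q)
        (constraint_projection G Q ** (B - V)) (transpose (B + V) ** Q) (N + W) T u x y"
  proof (intro allI impI)
    fix T u x l y
    assume T: "time_domain T" and sol: "pH_DAE_solution J R Q B V N W G T u x l y"
    note hidden = pH_DAE_solution_hidden_constraint[OF T sol]
    show "(\<forall>t\<in>T.
        (transpose G ** Q) *v (((J - R) ** Q) *v x t + (B - V) *v u t + G *v l t) = 0 \<and>
        l t = lagrange_multiplier J R Q B V G (x t) (u t)) \<and>
      iso_solution (constraint_projection G Q ** (J - R) ** Q)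
        (constraint_projection G Q ** (B - V)) (transpose (B + V) ** Q) (N + W) T u x y"
      using hidden hidden[unfolded lagrange_multiplier_iff[OF inv]]
        pH_DAE_solution_imp_iso_solution[OF inv T sol] by blast
  qed
  show "\<forall>\<xi> \<upsilon>.
      (\<forall>\<mu>. (transpose G ** Q) *v (((J - R) ** Q) *v \<xi> + (B - V) *v \<upsilon> + G *v \<mu>) = 0 \<longleftrightarrow>
           \<mu> = lagrange_multiplier J R Q B V G \<xi> \<upsilon>) \<and>
      ((J - R) ** Q) *v \<xi> + (B - V) *v \<upsilon> + G *v lagrange_multiplier J R Q B V G \<xi> \<upsilon> =
        (constraint_projection G Q ** (J - R) ** Q) *v \<xi>
          + (constraint_projection G Q ** (B - V)) *v \<upsilon>"
    using lagrange_multiplier_iff[OF inv] lagrange_multiplier_substitute by blast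
  show "Q_orthogonal_projection Q (constraint_projection G Q) (mat_ker (transpose G ** Q))"
    using inv assms(6) by (rule Q_orthogonal_projection_constraint_projection)
  show "invariant_subspace (constraint_projection G Q ** (J - R) ** Q)
      (constraint_projection G Q ** (B - V)) (mat_ker (transpose G ** Q))"
    \<comment> \<open>Both system matrices have the projection as their left factor, and
      \<open>G^T Q\<close> annihilates it.\<close>
    by (rule invariant_subspace_mat_ker)
      (simp_all only: matrix_mul_assoc constr[unfolded matrix_mul_assoc] times0_left)
  show "transfer_function (constraint_projection G Q ** (J - R) ** Q)
        (constraint_projection G Q ** (B - V)) (transpose (B + V) ** Q) (N + W) =
      rat_const_matrix (transpose (B + V) ** Q)
        ** matrix_inv (mat rat_s - rat_const_matrix (constraint_projection G Q ** (J - R) ** Q))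
        ** rat_const_matrix (constraint_projection G Q ** (B - V))
      + rat_const_matrix (N + W)"
    by (rule transfer_function_def)
next
  assume Q: "pos_def Q"
  show inv: "invertible (transpose G ** Q ** G)"
    using Q assms(8) by (rule pos_def_imp_invertible_congruence)
  \<comment> \<open>Reassociation exhibits the factor \<open>K\<close> required by the dissipation
    argument.\<close>
  have "constraint_projection G Q =
      mat 1 - G ** (matrix_inv (transpose G ** Q ** G) ** transpose G ** Q)"
    by (simp add: constraint_projection_def matrix_mul_assoc)
  then show "positive_real
      (transfer_function (constraint_projection G Q ** (J - R) ** Q)
        (constraint_projection G Q ** (B - V)) (transpose (B + V) ** Q) (N + W))"
    using assms(1,2,5) Q constraint_constraint_projection[OF inv]
    by (intro positive_real_constrained_transfer_function)
qed

end
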